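(* Let $M=M(\lambda)\in\mathbb{W}^{n\times n}$, let $\{1,\dots,n\}=S\cup\overline S$ be a partition with $S\ne\varnothing$, and let $\lambda_0\in\mathbb{C}$ be such that $M_{\overline S\,\overline S}(\lambda_0)-\lambda_0I$ is invertible. Then every eigenvector of the reduced matrix $R_S(\lambda)$ for $\lambda_0$ is the restriction to $S$ of an eigenvector of $M$ for $\lambda_0$, and the projection $u\mapsto u_S$ is a bijection from the set of eigenvectors of $M$ for $\lambda_0$ onto the set of eigenvectors of $R_S(\lambda)$ for $\lambda_0$.
   Context: $\mathbb{W}$ is the field of rational functions in $\lambda$ over $\mathbb{C}$. Writing $M(\lambda_0)$ presupposes that the entries have no pole at $\lambda_0$. An eigenvector of $A(\lambda)\in\mathbb{W}^{k\times k}$ for $\lambda_0$ is a vector $u\in\mathbb{C}^k$, $u\neq0$, with $A(\lambda_0)u=\lambda_0u$. For index sets $A,B$, $M_{AB}$ is the submatrix with rows in $A$ and columns in $B$, and $u_S=(u_i)_{i\in S}$. The isospectral (matrix) reduction of $M$ onto $S$ is $$R_S(\lambda)=M_{SS}-M_{S\overline S}(M_{\overline S\,\overline S}-\lambda I)^{-1}M_{\overline SS}.$$ *)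

theory Defs
  imports
    "HOL-Computational_Algebra.Field_as_Ring"
    "HOL-Computational_Algebra.Polynomial_Factorial"
    "Jordan_Normal_Form.Char_Poly"
    "Jordan_Normal_Form.Gauss_Jordan_Elimination"
    "Jordan_Normal_Form.DL_Submatrix"
begin

type_synonym ratfun = "complex poly fract"

definition ratfun_var :: ratfun where
  "ratfun_var = to_fract [:0, 1:]"

text \<open>The pair \<^const>\<open>quot_of_fract\<close> is in lowest terms, so the zeros of its second
  component are exactly the poles.\<close>

definition has_pole :: "ratfun \<Rightarrow> complex \<Rightarrow> bool" where
  "has_pole r z \<longleftrightarrow> poly (snd (quot_of_fract r)) z = 0"

definition ratfun_eval :: "ratfun \<Rightarrow> complex \<Rightarrow> complex" where
  "ratfun_eval r z = poly (fst (quot_of_fract r)) z / poly (snd (quot_of_fract r)) z"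

definition pole_free_mat :: "ratfun mat \<Rightarrow> complex \<Rightarrow> bool" where
  "pole_free_mat A z \<longleftrightarrow> (\<forall>i < dim_row A. \<forall>j < dim_col A. \<not> has_pole (A $$ (i, j)) z)"

text \<open>Only meaningful for \<^term>\<open>pole_free_mat A z\<close>; at a pole the entry is the
  junk value of a division by zero.\<close>

definition eval_mat :: "ratfun mat \<Rightarrow> complex \<Rightarrow> complex mat" where
  "eval_mat A z = map_mat (\<lambda>r. ratfun_eval r z) A"

definition ratfun_eigenvector :: "ratfun mat \<Rightarrow> complex vec \<Rightarrow> complex \<Rightarrow> bool" where
  "ratfun_eigenvector A u z \<longleftrightarrow> pole_free_mat A z \<and> eigenvector (eval_mat A z) u z"

text \<open>Indices run from \<open>0\<close>, so the index set of an \<open>n \<times> n\<close> matrix is \<open>{..<n}\<close>. As for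
  \<^const>\<open>submatrix\<close>, the indices in \<open>S\<close> are renumbered increasingly.\<close>

definition vec_restrict :: "'a vec \<Rightarrow> nat set \<Rightarrow> 'a vec" where
  "vec_restrict u S = vec (card {i. i < dim_vec u \<and> i \<in> S}) (\<lambda>i. u $ pick S i)"

text \<open>\<^const>\<open>mat_inverse\<close> yields \<^const>\<open>None\<close> when the block to be inverted is singular over
  the field of rational functions; the reduction is then unspecified.\<close>

definition isospectral_reduction :: "ratfun mat \<Rightarrow> nat set \<Rightarrow> ratfun mat" where
  "isospectral_reduction M S =
    (let T = {..<dim_row M} - S in
      submatrix M S S
      - submatrix M S T
        * the (mat_inverse (submatrix M T T - ratfun_var \<cdot>\<^sub>m 1\<^sub>m (card T)))
        * submatrix M T S)"

end

theory Submission
  imports Defs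
begin

text \<open>Write \<open>A = M(z)\<close>, let \<open>x\<close> and \<open>y\<close> be the restrictions of a vector \<open>u\<close> to \<open>S\<close> and \<open>T\<close>,
  and let \<open>B = A\<^bsub>TT\<^esub> - z I\<close>, which is invertible by hypothesis. The equation \<open>A u = z u\<close>
  splits into
  \<open>A\<^bsub>SS\<^esub> x + A\<^bsub>ST\<^esub> y = z x\<close> and \<open>A\<^bsub>TS\<^esub> x + B y = 0\<close>. The second equation determines \<open>y\<close> from
  \<open>x\<close>, namely \<open>y = - B\<^sup>-\<^sup>1 A\<^bsub>TS\<^esub> x\<close>, and substituting this into the first one leaves exactly the
  eigenvector equation of the Schur complement \<open>A\<^bsub>SS\<^esub> - A\<^bsub>ST\<^esub> B\<^sup>-\<^sup>1 A\<^bsub>TS\<^esub>\<close> for \<open>x\<close>. If \<open>x = 0\<close>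
  then \<open>y = 0\<close>, so nonzero vectors correspond to nonzero vectors. This Gaussian elimination is
  \<open>eigenvector_iff_schur_complement\<close>; since a vector can be glued freely and uniquely from its two
  restrictions, it yields the bijection \<open>bij_betw_eigenvectors_schur_complement\<close>.

  The other half of the argument shows that the reduction, which is formed over the field of
  rational functions, may be evaluated at \<open>z\<close> by evaluating its blocks, i.e. that its value is
  the Schur complement above. Evaluation is a ring homomorphism, but only on the rational
  functions without a pole at \<open>z\<close>, so the point to settle is that the inverse of
  \<open>M\<^bsub>TT\<^esub> - \<lambda> I\<close> exists and has no poles at \<open>z\<close>. Its determinant takes the value
  \<open>det B \<noteq> 0\<close> at \<open>z\<close>, hence is not the zero function, and its inverse is the adjugate divided by
  a function that does not vanish at \<open>z\<close>; this is \<open>mat_has_value_mat_inverse\<close>.\<close>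

section \<open>Values of rational functions at a point\<close>

text \<open>Absence of a pole and the value are combined in one relation because they depend on each
  other: values may be added and multiplied only away from poles, and an inverse has no pole
  only where the value is nonzero. A single derivation along the structure of an expression then
  gives both facts.\<close>

definition has_value :: "ratfun \<Rightarrow> complex \<Rightarrow> complex \<Rightarrow> bool" where
  "has_value r z c \<longleftrightarrow> \<not> has_pole r z \<and> ratfun_eval r z = c"

lemma has_value_unique: "has_value r z c \<Longrightarrow> has_value r z d \<Longrightarrow> c = d"
  by (simp add: has_value_def)

text \<open>The fraction \<open>a / b\<close> need not be in lowest terms: a factor cancelled in passing to lowest
  terms divides \<open>b\<close>, so it does not vanish at \<open>z\<close> and changes neither the absence of a pole nor
  the quotient of the values. With this lemma, arithmetic can use the naive formulas for
  fractions.\<close>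

lemma has_value_Fract:
  assumes "poly b z \<noteq> 0"
  shows "has_value (Fraction_Field.Fract a b) z (poly a z / poly b z)"
proof -
  have b0: "b \<noteq> 0"
    using assms by auto
  have q: "quot_of_fract (Fraction_Field.Fract a b) = normalize_quot (a, b)"
    using quot_of_fract_quot_to_fract[of "(a, b)"] by (simp add: quot_to_fract_def)
  obtain d where d: "a = fst (normalize_quot (a, b)) * d" "b = snd (normalize_quot (a, b)) * d"
    using normalize_quotE[OF b0] by metis
  have a': "poly a z = poly (fst (normalize_quot (a, b))) z * poly d z"
    by (metis d(1) poly_mult)
  have b': "poly b z = poly (snd (normalize_quot (a, b))) z * poly d z"
    by (metis d(2) poly_mult)
  show ?thesis
    using assms unfolding has_value_def has_pole_def ratfun_eval_def q a' b' by auto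
qed

lemma has_value_cases:
  assumes "has_value r z c"
  obtains a b where "r = Fraction_Field.Fract a b" "poly b z \<noteq> 0" "c = poly a z / poly b z"
proof
  show "r = Fraction_Field.Fract (fst (quot_of_fract r)) (snd (quot_of_fract r))"
    using quot_to_fract_quot_of_fract[of r] by (simp add: quot_to_fract_def case_prod_unfold)
qed (use assms in \<open>auto simp: has_value_def has_pole_def ratfun_eval_def\<close>)

lemma has_value_to_fract: "has_value (to_fract p) z (poly p z)"
  using has_value_Fract[of 1 z p] by (simp add: to_fract_def)

lemma has_value_0: "has_value 0 z 0"
  using has_value_to_fract[of 0 z] by simp

lemma has_value_1: "has_value 1 z 1"
  using has_value_to_fract[of 1 z] by simp

lemma has_value_ratfun_var: "has_value ratfun_var z z"
  using has_value_to_fract[of "[:0, 1:]" z] by (simp add: ratfun_var_def)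

lemma has_value_add:
  assumes "has_value r z c" "has_value s z d"
  shows "has_value (r + s) z (c + d)"
proof -
  obtain a b where r: "r = Fraction_Field.Fract a b" "poly b z \<noteq> 0" "c = poly a z / poly b z"
    using assms(1) by (rule has_value_cases)
  obtain a' b' where s: "s = Fraction_Field.Fract a' b'" "poly b' z \<noteq> 0" "d = poly a' z / poly b' z"
    using assms(2) by (rule has_value_cases)
  have "b \<noteq> 0" "b' \<noteq> 0"
    using r(2) s(2) by auto
  then show ?thesis
    using has_value_Fract[of "b * b'" z "a * b' + a' * b"] r s
    by (simp add: add_frac_eq)
qed

lemma has_value_mult:
  assumes "has_value r z c" "has_value s z d"
  shows "has_value (r * s) z (c * d)"
proof -
  obtain a b where r: "r = Fraction_Field.Fract a b" "poly b z \<noteq> 0" "c = poly a z / poly b z"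
    using assms(1) by (rule has_value_cases)
  obtain a' b' where s: "s = Fraction_Field.Fract a' b'" "poly b' z \<noteq> 0" "d = poly a' z / poly b' z"
    using assms(2) by (rule has_value_cases)
  show ?thesis
    using has_value_Fract[of "b * b'" z "a * a'"] r s by simp
qed

lemma has_value_inverse:
  assumes "has_value r z c" "c \<noteq> 0"
  shows "has_value (inverse r) z (inverse c)"
proof -
  obtain a b where r: "r = Fraction_Field.Fract a b" "poly b z \<noteq> 0" "c = poly a z / poly b z"
    using assms(1) by (rule has_value_cases)
  show ?thesis
    using has_value_Fract[of a z b] r assms(2) by simp
qed

lemma has_value_uminus: "has_value r z c \<Longrightarrow> has_value (- r) z (- c)"
  using has_value_mult[OF has_value_to_fract[of "- 1" z]] by fastforce

lemma has_value_diff: "has_value r z c \<Longrightarrow> has_value s z d \<Longrightarrow> has_value (r - s) z (c - d)"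
  using has_value_add[OF _ has_value_uminus] by fastforce

lemma has_value_sum:
  assumes "\<And>x. x \<in> X \<Longrightarrow> has_value (f x) z (g x)"
  shows "has_value (sum f X) z (sum g X)"
  using assms by (induction X rule: infinite_finite_induct) (auto intro: has_value_0 has_value_add)

lemma has_value_prod:
  assumes "\<And>x. x \<in> X \<Longrightarrow> has_value (f x) z (g x)"
  shows "has_value (prod f X) z (prod g X)"
  using assms by (induction X rule: infinite_finite_induct) (auto intro: has_value_1 has_value_mult)

lemma has_value_power: "has_value r z c \<Longrightarrow> has_value (r ^ k) z (c ^ k)"
  by (induction k) (auto intro: has_value_1 has_value_mult)

lemma has_value_sign: "has_value (of_int (sign p)) z (of_int (sign p))"
  by (auto simp: sign_def intro: has_value_1 has_value_uminus)

section \<open>Values of matrices of rational functions\<close>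

definition mat_has_value :: "ratfun mat \<Rightarrow> complex \<Rightarrow> complex mat \<Rightarrow> bool" where
  "mat_has_value A z B \<longleftrightarrow> pole_free_mat A z \<and> eval_mat A z = B"

lemma mat_has_value_iff:
  assumes "A \<in> carrier_mat m n" "B \<in> carrier_mat m n"
  shows "mat_has_value A z B \<longleftrightarrow> (\<forall>i<m. \<forall>j<n. has_value (A $$ (i, j)) z (B $$ (i, j)))"
  using assms unfolding mat_has_value_def pole_free_mat_def eval_mat_def has_value_def
  by (auto simp: mat_eq_iff)

lemma mat_has_value_unique: "mat_has_value A z B \<Longrightarrow> mat_has_value A z C \<Longrightarrow> B = C"
  by (simp add: mat_has_value_def)

lemma mat_has_value_one: "mat_has_value (1\<^sub>m n) z (1\<^sub>m n)"
  by (subst mat_has_value_iff[of _ n n]) (auto intro: has_value_0 has_value_1)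

lemma mat_has_value_smult:
  assumes "A \<in> carrier_mat m n" "B \<in> carrier_mat m n" "mat_has_value A z B" "has_value r z c"
  shows "mat_has_value (r \<cdot>\<^sub>m A) z (c \<cdot>\<^sub>m B)"
  using assms by (subst mat_has_value_iff[of _ m n]) (auto simp: mat_has_value_iff intro: has_value_mult)

lemma mat_has_value_minus:
  assumes "A \<in> carrier_mat m n" "B \<in> carrier_mat m n" "mat_has_value A z B"
    and "A' \<in> carrier_mat m n" "B' \<in> carrier_mat m n" "mat_has_value A' z B'"
  shows "mat_has_value (A - A') z (B - B')"
  using assms by (subst mat_has_value_iff[of _ m n]) (auto simp: mat_has_value_iff intro: has_value_diff)

lemma mat_has_value_mult:
  assumes "A \<in> carrier_mat m n" "B \<in> carrier_mat m n" "mat_has_value A z B"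
    and "A' \<in> carrier_mat n k" "B' \<in> carrier_mat n k" "mat_has_value A' z B'"
  shows "mat_has_value (A * A') z (B * B')"
  using assms
  by (subst mat_has_value_iff[of _ m k])
     (auto simp: mat_has_value_iff scalar_prod_def intro!: has_value_sum has_value_mult)

text \<open>Evaluation is not a homomorphism on the whole field of rational functions, so the
  general fact that ring homomorphisms commute with determinants does not apply; the
  Leibniz formula is evaluated term by term.\<close>

lemma mat_has_value_det:
  assumes "A \<in> carrier_mat n n" "B \<in> carrier_mat n n" "mat_has_value A z B"
  shows "has_value (det A) z (det B)"
  unfolding det_def'[OF assms(1)] det_def'[OF assms(2)]
proof (intro has_value_sum has_value_mult has_value_sign has_value_prod)
  fix p i assume "p \<in> {p. p permutes {0..<n}}" "i \<in> {0..<n}"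
  then have "i < n" "p i < n"
    using permutes_in_image[of p "{0..<n}" i] by auto
  then show "has_value (A $$ (i, p i)) z (B $$ (i, p i))"
    using assms by (simp add: mat_has_value_iff)
qed

lemma mat_has_value_adj_mat:
  assumes "A \<in> carrier_mat n n" "B \<in> carrier_mat n n" "mat_has_value A z B"
  shows "mat_has_value (adj_mat A) z (adj_mat B)"
proof -
  have minor: "has_value (det (mat_delete A j i)) z (det (mat_delete B j i))" if ij: "i < n" "j < n" for i j
  proof (rule mat_has_value_det)
    show c: "mat_delete A j i \<in> carrier_mat (n - 1) (n - 1)" "mat_delete B j i \<in> carrier_mat (n - 1) (n - 1)"
      using assms by (auto simp: mat_delete_def)
    show "mat_has_value (mat_delete A j i) z (mat_delete B j i)"
      using assms unfolding mat_has_value_iff[OF c] by (auto simp: mat_has_value_iff mat_delete_def)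
  qed
  have sign: "has_value ((- 1) ^ k) z ((- 1) ^ k)" for k
    by (intro has_value_power has_value_uminus has_value_1)
  show ?thesis
    using assms by (subst mat_has_value_iff[of _ n n])
      (auto simp: adj_mat_def cofactor_def intro!: has_value_mult sign minor)
qed

text \<open>An inverse of \<open>B\<close> gives \<open>det B \<noteq> 0\<close>, and \<open>det A\<close> has this value at \<open>z\<close>. So \<open>A\<close> is
  invertible over the rational functions, and the entries of its inverse, being cofactors divided
  by \<open>det A\<close>, have no pole at \<open>z\<close>. That their values form an inverse of \<open>B\<close> is seen by evaluating
  \<open>A A\<^sup>-\<^sup>1 = A\<^sup>-\<^sup>1 A = I\<close>.\<close>

lemma mat_has_value_mat_inverse:
  assumes A: "A \<in> carrier_mat n n" and AB: "mat_has_value A z B" and inv: "invertible_mat B"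
  obtains D where "D \<in> carrier_mat n n" "the (mat_inverse A) \<in> carrier_mat n n"
    "mat_has_value (the (mat_inverse A)) z D" "B * D = 1\<^sub>m n" "D * B = 1\<^sub>m n"
proof -
  have B: "B \<in> carrier_mat n n"
    using A AB by (auto simp: mat_has_value_def eval_mat_def)
  obtain E where E: "B * E = 1\<^sub>m n" "E * B = 1\<^sub>m (dim_row E)"
    using inv B by (auto simp: invertible_mat_def inverts_mat_def)
  have "dim_row E = n"
    using arg_cong[OF E(2), of dim_col] B by simp
  moreover have "dim_col E = n"
    using arg_cong[OF E(1), of dim_col] by simp
  ultimately have "E \<in> carrier_mat n n"
    by auto
  then have "det B * det E = 1"
    using det_mult[OF B, of E] E(1) by simp
  then have detB: "det B \<noteq> 0"
    by auto
  have detv: "has_value (det A) z (det B)"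
    using mat_has_value_det[OF A B AB] .
  then have detA: "det A \<noteq> 0"
    using detB has_value_unique[OF has_value_0] by metis
  define C where "C = the (mat_inverse A)"
  have "mat_inverse A = Some C"
    using mat_inverse(1)[OF A] det_non_zero_imp_unit[OF A detA] unfolding C_def by fastforce
  then have C: "A * C = 1\<^sub>m n" "C * A = 1\<^sub>m n" "C \<in> carrier_mat n n"
    using mat_inverse(2)[OF A] by auto
  have adj: "adj_mat A \<in> carrier_mat n n"
    using adj_mat[OF A] by simp
  \<comment> \<open>By uniqueness of inverses, \<open>C\<close> has the entries that Cramer's rule predicts.\<close>
  have "adj_mat A = C * A * adj_mat A"
    using C adj by simp
  also have "\<dots> = C * (A * adj_mat A)"
    using C(3) A adj by (rule assoc_mult_mat)
  also have "\<dots> = det A \<cdot>\<^sub>m C"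
    using adj_mat(2)[OF A] C(3) by (simp add: mult_smult_distrib[OF C(3) one_carrier_mat])
  finally have "C = inverse (det A) \<cdot>\<^sub>m adj_mat A"
    using detA by (auto simp: mat_eq_iff)
  moreover define D where "D = inverse (det B) \<cdot>\<^sub>m adj_mat B"
  ultimately have CD: "mat_has_value C z D"
    using mat_has_value_smult[OF adj adj_mat(1)[OF B] mat_has_value_adj_mat[OF A B AB] has_value_inverse[OF detv detB]]
    by simp
  have D: "D \<in> carrier_mat n n"
    using adj_mat(1)[OF B] by (simp add: D_def)
  have "B * D = 1\<^sub>m n"
    using mat_has_value_mult[OF A B AB C(3) D CD] C(1) mat_has_value_one mat_has_value_unique by metis
  moreover have "D * B = 1\<^sub>m n"
    using mat_has_value_mult[OF C(3) D CD A B AB] C(2) mat_has_value_one mat_has_value_unique by metis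
  ultimately show ?thesis
    using that D C(3) CD unfolding C_def by blast
qed

section \<open>Splitting vectors and matrices along a partition of the indices\<close>

lemma card_below_subset:
  assumes "I \<subseteq> {..<n}"
  shows "card {i. i < n \<and> i \<in> I} = card I"
proof -
  have "{i. i < n \<and> i \<in> I} = I"
    using assms by auto
  then show ?thesis by simp
qed

lemma submatrix_carrier:
  assumes "A \<in> carrier_mat m n" "I \<subseteq> {..<m}" "J \<subseteq> {..<n}"
  shows "submatrix A I J \<in> carrier_mat (card I) (card J)"
  using assms by (auto simp: submatrix_def card_below_subset)

lemma submatrix_index_pick:
  assumes "A \<in> carrier_mat m n" "I \<subseteq> {..<m}" "J \<subseteq> {..<n}" "i < card I" "j < card J"
  shows "submatrix A I J $$ (i, j) = A $$ (pick I i, pick J j)"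
  using assms by (auto simp: submatrix_def card_below_subset)

lemma vec_restrict_carrier:
  assumes "u \<in> carrier_vec n" "I \<subseteq> {..<n}"
  shows "vec_restrict u I \<in> carrier_vec (card I)"
  using assms by (auto simp: vec_restrict_def card_below_subset)

lemma vec_restrict_index:
  assumes "u \<in> carrier_vec n" "I \<subseteq> {..<n}" "i < card I"
  shows "vec_restrict u I $ i = u $ pick I i"
  using assms by (auto simp: vec_restrict_def card_below_subset)

lemma bij_betw_pick:
  assumes "finite I"
  shows "bij_betw (pick I) {..<card I} I"
proof (rule bij_betw_byWitness[where f' = "\<lambda>i. card {a \<in> I. a < i}"])
  show "(\<lambda>i. card {a \<in> I. a < i}) ` I \<subseteq> {..<card I}"
    using assms by (auto intro!: psubset_card_mono)
qed (auto simp: card_pick_le pick_card_in_set pick_in_set_le)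

lemma vec_restrict_smult:
  assumes "u \<in> carrier_vec n" "I \<subseteq> {..<n}"
  shows "vec_restrict (c \<cdot>\<^sub>v u) I = c \<cdot>\<^sub>v vec_restrict u I"
proof -
  have "pick I i < n" if "i < card I" for i
    using pick_in_set_le[OF that] assms(2) by auto
  then show ?thesis
    using assms by (intro eq_vecI) (auto simp: vec_restrict_def card_below_subset)
qed

lemma vec_restrict_zero:
  assumes "I \<subseteq> {..<n}"
  shows "vec_restrict (0\<^sub>v n) I = 0\<^sub>v (card I)"
proof -
  have "pick I i < n" if "i < card I" for i
    using pick_in_set_le[OF that] assms by auto
  then show ?thesis
    using assms by (intro eq_vecI) (auto simp: vec_restrict_def card_below_subset)
qed


text \<open>This and the next lemma make \<open>u \<mapsto> (u\<^bsub>S\<^esub>, u\<^bsub>T\<^esub>)\<close> a bijection: every index is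
  enumerated by \<open>pick S\<close> or by \<open>pick T\<close>.\<close>

lemma vec_restrict_eqD:
  assumes u: "u \<in> carrier_vec n" and u': "u' \<in> carrier_vec n" and ST: "S \<union> T = {..<n}"
    and "vec_restrict u S = vec_restrict u' S" "vec_restrict u T = vec_restrict u' T"
  shows "u = u'"
proof (rule eq_vecI)
  have *: "u $ i = u' $ i" if "i \<in> I" "I \<subseteq> {..<n}" "vec_restrict u I = vec_restrict u' I" for I i
  proof -
    have "finite I"
      using that(2) finite_subset by blast
    then have "i \<in> pick I ` {..<card I}"
      using bij_betw_imp_surj_on[OF bij_betw_pick] that(1) by blast
    then obtain k where k: "k < card I" "i = pick I k"
      by auto
    show ?thesis
      unfolding k(2) vec_restrict_index[OF u that(2) k(1), symmetric]
        vec_restrict_index[OF u' that(2) k(1), symmetric]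
      by (simp only: that(3))
  qed
  fix i assume "i < dim_vec u'"
  then have "i \<in> S \<union> T"
    using ST u' by simp
  moreover have "S \<subseteq> {..<n}" "T \<subseteq> {..<n}"
    using ST by blast+
  ultimately show "u $ i = u' $ i"
    using * assms(4,5) by blast
qed (use u u' in auto)

lemma vec_restrict_glue:
  assumes ST: "S \<union> T = {..<n}" "S \<inter> T = {}"
    and v: "v \<in> carrier_vec (card S)" and w: "w \<in> carrier_vec (card T)"
  obtains u where "u \<in> carrier_vec n" "vec_restrict u S = v" "vec_restrict u T = w"
proof
  define u where "u = vec n (\<lambda>i. if i \<in> S then v $ card {a \<in> S. a < i} else w $ card {a \<in> T. a < i})"
  show u: "u \<in> carrier_vec n"
    by (simp add: u_def)
  have sub: "S \<subseteq> {..<n}" "T \<subseteq> {..<n}"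
    using ST by auto
  show "vec_restrict u S = v"
  proof (rule eq_vecI)
    fix i assume "i < dim_vec v"
    then have i: "i < card S"
      using v by simp
    then show "vec_restrict u S $ i = v $ i"
      using pick_in_set_le[OF i] sub vec_restrict_index[OF u sub(1) i]
      by (auto simp: u_def card_pick_le subset_iff)
  qed (use vec_restrict_carrier[OF u sub(1)] v in auto)
  show "vec_restrict u T = w"
  proof (rule eq_vecI)
    fix i assume "i < dim_vec w"
    then have i: "i < card T"
      using w by simp
    moreover have "pick T i \<in> T" "pick T i \<notin> S" "pick T i < n"
      using pick_in_set_le[OF i] ST(2) sub by auto
    ultimately show "vec_restrict u T $ i = w $ i"
      using vec_restrict_index[OF u sub(2) i] by (auto simp: u_def card_pick_le)
  qed (use vec_restrict_carrier[OF u sub(2)] w in auto)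
qed

text \<open>Block multiplication for blocks that need not be contiguous: the sum over all column
  indices splits into the sums over \<open>S\<close> and \<open>T\<close>, each reindexed by \<^const>\<open>pick\<close>.\<close>

lemma vec_restrict_mult_mat_vec:
  fixes A :: "'a :: comm_ring_1 mat"
  assumes A: "A \<in> carrier_mat n n" and u: "u \<in> carrier_vec n"
    and ST: "S \<union> T = {..<n}" "S \<inter> T = {}" and I: "I \<subseteq> {..<n}"
  shows "vec_restrict (A *\<^sub>v u) I
    = submatrix A I S *\<^sub>v vec_restrict u S + submatrix A I T *\<^sub>v vec_restrict u T"
proof (rule eq_vecI)
  have sub: "S \<subseteq> {..<n}" "T \<subseteq> {..<n}"
    using ST by auto
  have fin: "finite S" "finite T"
    using sub finite_subset by blast+
  have Au: "A *\<^sub>v u \<in> carrier_vec n"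
    using A u by simp
  have AI: "submatrix A I J \<in> carrier_mat (card I) (card J)" if "J \<subseteq> {..<n}" for J
    using submatrix_carrier[OF A I that] .
  show "dim_vec (vec_restrict (A *\<^sub>v u) I)
    = dim_vec (submatrix A I S *\<^sub>v vec_restrict u S + submatrix A I T *\<^sub>v vec_restrict u T)"
    using vec_restrict_carrier[OF Au I] AI[OF sub(2)] by auto
  fix i
  assume "i < dim_vec (submatrix A I S *\<^sub>v vec_restrict u S + submatrix A I T *\<^sub>v vec_restrict u T)"
  then have i: "i < card I"
    using AI[OF sub(2)] by auto
  define f where "f j = A $$ (pick I i, j) * u $ j" for j
  have block: "(submatrix A I J *\<^sub>v vec_restrict u J) $ i = sum f J" if J: "J \<subseteq> {..<n}" for J
  proof -
    have "(submatrix A I J *\<^sub>v vec_restrict u J) $ i = (\<Sum>j<card J. f (pick J j))"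
      using i AI[OF J] vec_restrict_carrier[OF u J]
      by (auto simp: scalar_prod_def f_def vec_restrict_index[OF u J] submatrix_index_pick[OF A I J]
          lessThan_atLeast0)
    also have "\<dots> = sum f J"
      using sum.reindex_bij_betw[OF bij_betw_pick] J finite_subset by blast
    finally show ?thesis .
  qed
  have "pick I i < n"
    using pick_in_set_le[OF i] I by auto
  then have "vec_restrict (A *\<^sub>v u) I $ i = sum f {..<n}"
    using vec_restrict_index[OF Au I i] A u
    by (auto simp: scalar_prod_def f_def lessThan_atLeast0)
  also have "\<dots> = sum f S + sum f T"
    using sum.union_disjoint[OF fin ST(2)] ST(1) by metis
  finally show "vec_restrict (A *\<^sub>v u) I $ i
    = (submatrix A I S *\<^sub>v vec_restrict u S + submatrix A I T *\<^sub>v vec_restrict u T) $ i"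
    using block[OF sub(1)] block[OF sub(2)] i AI[OF sub(2)] by auto
qed

section \<open>Eliminating the complementary block of an eigenvector\<close>

lemma smult_one_mat_mult_vec:
  fixes v :: "'a :: comm_ring_1 vec"
  assumes "v \<in> carrier_vec n"
  shows "(c \<cdot>\<^sub>m 1\<^sub>m n) *\<^sub>v v = c \<cdot>\<^sub>v v"
  using assms by (intro eq_vecI) auto

lemma mult_mat_vec_uminus:
  fixes A :: "'a :: comm_ring_1 mat"
  assumes "A \<in> carrier_mat m n" "v \<in> carrier_vec n"
  shows "A *\<^sub>v (- v) = - (A *\<^sub>v v)"
  using assms by (intro eq_vecI) auto

text \<open>Gaussian elimination of the \<open>T\<close>-part. The matrix \<open>D\<close> is the inverse of
  \<open>A\<^bsub>TT\<^esub> - z I\<close>; the equation for the \<open>T\<close>-part says that \<open>A\<^bsub>TT\<^esub> - z I\<close> maps \<open>u\<^bsub>T\<^esub>\<close> to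
  \<open>- A\<^bsub>TS\<^esub> u\<^bsub>S\<^esub>\<close>.\<close>

lemma eigenvector_iff_schur_complement:
  fixes A :: "'a :: field mat"
  assumes A: "A \<in> carrier_mat n n" and ST: "S \<union> T = {..<n}" "S \<inter> T = {}"
    and D: "D \<in> carrier_mat (card T) (card T)"
    and inv: "(submatrix A T T - z \<cdot>\<^sub>m 1\<^sub>m (card T)) * D = 1\<^sub>m (card T)"
      "D * (submatrix A T T - z \<cdot>\<^sub>m 1\<^sub>m (card T)) = 1\<^sub>m (card T)"
    and u: "u \<in> carrier_vec n"
  shows "eigenvector A u z \<longleftrightarrow>
    eigenvector (submatrix A S S - submatrix A S T * D * submatrix A T S) (vec_restrict u S) z
    \<and> vec_restrict u T = - (D *\<^sub>v (submatrix A T S *\<^sub>v vec_restrict u S))"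
    (is "_ \<longleftrightarrow> eigenvector ?R ?x z \<and> ?y = ?w")
proof -
  let ?B = "submatrix A T T - z \<cdot>\<^sub>m 1\<^sub>m (card T)"
  have sub: "S \<subseteq> {..<n}" "T \<subseteq> {..<n}"
    using ST by auto
  note c = submatrix_carrier[OF A sub(1) sub(1)] submatrix_carrier[OF A sub(1) sub(2)]
    submatrix_carrier[OF A sub(2) sub(1)] submatrix_carrier[OF A sub(2) sub(2)]
  have x: "?x \<in> carrier_vec (card S)" and y: "?y \<in> carrier_vec (card T)"
    using vec_restrict_carrier[OF u] sub by auto
  have Au: "A *\<^sub>v u \<in> carrier_vec n"
    using A u by simp
  define p where "p = submatrix A T S *\<^sub>v ?x"
  have p: "p \<in> carrier_vec (card T)"
    using c x by (simp add: p_def)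
  have B: "?B \<in> carrier_mat (card T) (card T)"
    using c by (intro minus_carrier_mat) auto
  have "A *\<^sub>v u = z \<cdot>\<^sub>v u \<longleftrightarrow>
      vec_restrict (A *\<^sub>v u) S = vec_restrict (z \<cdot>\<^sub>v u) S \<and>
      vec_restrict (A *\<^sub>v u) T = vec_restrict (z \<cdot>\<^sub>v u) T"
    using vec_restrict_eqD[OF Au _ ST(1), of "z \<cdot>\<^sub>v u"] u by auto
  also have "\<dots> \<longleftrightarrow> submatrix A S S *\<^sub>v ?x + submatrix A S T *\<^sub>v ?y = z \<cdot>\<^sub>v ?x
      \<and> p + submatrix A T T *\<^sub>v ?y = z \<cdot>\<^sub>v ?y"
    unfolding vec_restrict_mult_mat_vec[OF A u ST sub(1)] vec_restrict_mult_mat_vec[OF A u ST sub(2)]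
      vec_restrict_smult[OF u sub(1)] vec_restrict_smult[OF u sub(2)] p_def ..
  also have "p + submatrix A T T *\<^sub>v ?y = z \<cdot>\<^sub>v ?y \<longleftrightarrow> ?B *\<^sub>v ?y = - p"
  proof -
    have "?B *\<^sub>v ?y = submatrix A T T *\<^sub>v ?y - z \<cdot>\<^sub>v ?y"
      using c y by (simp add: minus_mult_distrib_mat_vec smult_one_mat_mult_vec[OF y])
    then show ?thesis
      using c y p by (auto simp: vec_eq_iff algebra_simps eq_neg_iff_add_eq_0)
  qed
  also have "?B *\<^sub>v ?y = - p \<longleftrightarrow> ?y = ?w"
  proof
    assume *: "?B *\<^sub>v ?y = - p"
    have "?y = D *\<^sub>v (?B *\<^sub>v ?y)"
      using inv(2) y assoc_mult_mat_vec[OF D B y] by simp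
    then show "?y = ?w"
      using mult_mat_vec_uminus[OF D p] by (simp only: * p_def)
  next
    assume *: "?y = ?w"
    have "D *\<^sub>v p \<in> carrier_vec (card T)"
      using D p by simp
    then have "?B *\<^sub>v ?y = - (?B *\<^sub>v (D *\<^sub>v p))"
      using mult_mat_vec_uminus[OF B] * by (simp only: p_def)
    also have "?B *\<^sub>v (D *\<^sub>v p) = p"
      using inv(1) p assoc_mult_mat_vec[OF B D p] by simp
    finally show "?B *\<^sub>v ?y = - p" .
  qed
  also have "submatrix A S S *\<^sub>v ?x + submatrix A S T *\<^sub>v ?y = z \<cdot>\<^sub>v ?x \<and> ?y = ?w
      \<longleftrightarrow> ?R *\<^sub>v ?x = z \<cdot>\<^sub>v ?x \<and> ?y = ?w"
  proof -
    have Dp: "D *\<^sub>v p \<in> carrier_vec (card T)"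
      using D p by simp
    have "(submatrix A S T * D * submatrix A T S) *\<^sub>v ?x = submatrix A S T *\<^sub>v (D *\<^sub>v p)"
      unfolding p_def assoc_mult_mat_vec[OF mult_carrier_mat[OF c(2) D] c(3) x]
      using assoc_mult_mat_vec[OF c(2) D p] unfolding p_def .
    then have "?R *\<^sub>v ?x = submatrix A S S *\<^sub>v ?x - submatrix A S T *\<^sub>v (D *\<^sub>v p)"
      using minus_mult_distrib_mat_vec[OF c(1) mult_carrier_mat[OF mult_carrier_mat[OF c(2) D] c(3)] x]
      by simp
    also have "\<dots> = submatrix A S S *\<^sub>v ?x + - (submatrix A S T *\<^sub>v (D *\<^sub>v p))"
      using c x Dp by (intro eq_vecI) auto
    also have "\<dots> = submatrix A S S *\<^sub>v ?x + submatrix A S T *\<^sub>v ?w"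
      using mult_mat_vec_uminus[OF c(2) Dp] by (simp only: p_def)
    finally have "?R *\<^sub>v ?x = submatrix A S S *\<^sub>v ?x + submatrix A S T *\<^sub>v ?w" .
    then show ?thesis
      by auto
  qed
  finally have eq: "A *\<^sub>v u = z \<cdot>\<^sub>v u \<longleftrightarrow> ?R *\<^sub>v ?x = z \<cdot>\<^sub>v ?x \<and> ?y = ?w" .
  have nonzero: "u = 0\<^sub>v n \<longleftrightarrow> ?x = 0\<^sub>v (card S)" if yw: "?y = ?w"
  proof
    assume "u = 0\<^sub>v n"
    then show "?x = 0\<^sub>v (card S)"
      using vec_restrict_zero[OF sub(1)] by blast
  next
    assume x0: "?x = 0\<^sub>v (card S)"
    show "u = 0\<^sub>v n"
    proof (rule vec_restrict_eqD[OF u _ ST(1)])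
      have zero: "X *\<^sub>v 0\<^sub>v l = 0\<^sub>v k" if "X \<in> carrier_mat k l" for X :: "'a mat" and k l
        using that by (intro eq_vecI) auto
      have "?w = 0\<^sub>v (card T)"
        by (simp only: x0 zero[OF c(3)] zero[OF D]) auto
      then show "?y = vec_restrict (0\<^sub>v n) T"
        by (simp only: yw vec_restrict_zero[OF sub(2)])
    qed (simp_all only: x0 vec_restrict_zero[OF sub(1)] zero_carrier_vec)
  qed
  have dims: "dim_row A = n" "dim_row ?R = card S"
    using A c D by simp_all
  show ?thesis
  proof (cases "?y = ?w")
    case True
    show ?thesis
      by (simp only: eigenvector_def dims eq u x nonzero[OF True] simp_thms True)
  next
    case False
    then show ?thesis
      by (simp only: eigenvector_def dims eq simp_thms)
  qed
qed

text \<open>The \<open>S\<close>-part of an eigenvector determines its \<open>T\<close>-part, which gives injectivity; for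
  surjectivity, an eigenvector of the Schur complement is glued with the \<open>T\<close>-part that it
  determines.\<close>

lemma bij_betw_eigenvectors_schur_complement:
  fixes A :: "'a :: field mat"
  assumes A: "A \<in> carrier_mat n n" and ST: "S \<union> T = {..<n}" "S \<inter> T = {}"
    and D: "D \<in> carrier_mat (card T) (card T)"
    and inv: "(submatrix A T T - z \<cdot>\<^sub>m 1\<^sub>m (card T)) * D = 1\<^sub>m (card T)"
      "D * (submatrix A T T - z \<cdot>\<^sub>m 1\<^sub>m (card T)) = 1\<^sub>m (card T)"
  shows "bij_betw (\<lambda>u. vec_restrict u S) {u. eigenvector A u z}
    {v. eigenvector (submatrix A S S - submatrix A S T * D * submatrix A T S) v z}"
    (is "bij_betw _ _ {v. eigenvector ?R v z}")
proof -
  note iff = eigenvector_iff_schur_complement[OF A ST D inv]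
  have sub: "S \<subseteq> {..<n}" "T \<subseteq> {..<n}"
    using ST by auto
  note c = submatrix_carrier[OF A sub(1) sub(1)] submatrix_carrier[OF A sub(1) sub(2)]
    submatrix_carrier[OF A sub(2) sub(1)]
  have carr: "u \<in> carrier_vec n" if "eigenvector A u z" for u
    using that A by (auto simp: eigenvector_def)
  show ?thesis
  proof (rule bij_betw_imageI)
    show "inj_on (\<lambda>u. vec_restrict u S) {u. eigenvector A u z}"
    proof (rule inj_onI)
      fix u u'
      assume "u \<in> {u. eigenvector A u z}" "u' \<in> {u. eigenvector A u z}"
        and S: "vec_restrict u S = vec_restrict u' S"
      then have e: "eigenvector A u z" "eigenvector A u' z"
        by auto
      have "vec_restrict u T = vec_restrict u' T"
        using iff[OF carr] e S by metis
      then show "u = u'"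
        using vec_restrict_eqD[OF carr carr ST(1)] e S by blast
    qed
    show "(\<lambda>u. vec_restrict u S) ` {u. eigenvector A u z} = {v. eigenvector ?R v z}"
    proof (intro equalityI subsetI)
      fix v assume "v \<in> {v. eigenvector ?R v z}"
      then have e: "eigenvector ?R v z"
        by simp
      then have v: "v \<in> carrier_vec (card S)"
        using c by (simp add: eigenvector_def)
      have "- (D *\<^sub>v (submatrix A T S *\<^sub>v v)) \<in> carrier_vec (card T)"
        using c D v by simp
      then obtain u where u: "u \<in> carrier_vec n" "vec_restrict u S = v"
        "vec_restrict u T = - (D *\<^sub>v (submatrix A T S *\<^sub>v v))"
        using vec_restrict_glue[OF ST v] by metis
      then have "eigenvector A u z"
        using iff[OF u(1)] e by simp
      then show "v \<in> (\<lambda>u. vec_restrict u S) ` {u. eigenvector A u z}"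
        using u(2) by blast
    qed (use iff carr in auto)
  qed
qed

section \<open>The isospectral reduction\<close>

lemma mat_has_value_submatrix:
  assumes M: "M \<in> carrier_mat m n" and I: "I \<subseteq> {..<m}" and J: "J \<subseteq> {..<n}" and "pole_free_mat M z"
  shows "mat_has_value (submatrix M I J) z (submatrix (eval_mat M z) I J)"
proof -
  have E: "eval_mat M z \<in> carrier_mat m n"
    using M by (simp add: eval_mat_def)
  have MV: "mat_has_value M z (eval_mat M z)"
    using assms(4) by (simp add: mat_has_value_def)
  have "pick I i < m" if "i < card I" for i
    using pick_in_set_le[OF that] I by auto
  moreover have "pick J j < n" if "j < card J" for j
    using pick_in_set_le[OF that] J by auto
  ultimately show ?thesis
    using MV unfolding mat_has_value_iff[OF M E]
      mat_has_value_iff[OF submatrix_carrier[OF M I J] submatrix_carrier[OF E I J]]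
    by (simp add: submatrix_index_pick[OF M I J] submatrix_index_pick[OF E I J])
qed

theorem theorem3:
  fixes M :: "complex poly fract mat" and n :: nat and S T :: "nat set" and z :: complex
  assumes "M \<in> carrier_mat n n"
    and "S \<union> T = {..<n}" and "S \<inter> T = {}" and "S \<noteq> {}"
    and "pole_free_mat M z"
    and "invertible_mat (eval_mat (submatrix M T T) z - z \<cdot>\<^sub>m 1\<^sub>m (card T))"
  shows "pole_free_mat (isospectral_reduction M S) z
    \<and> (\<forall>v. ratfun_eigenvector (isospectral_reduction M S) v z \<longrightarrow>
          (\<exists>u. ratfun_eigenvector M u z \<and> v = vec_restrict u S))
    \<and> bij_betw (\<lambda>u. vec_restrict u S)
        {u. ratfun_eigenvector M u z}
        {v. ratfun_eigenvector (isospectral_reduction M S) v z}"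
proof -
  note M = assms(1) and ST = assms(2,3) and pf = assms(5)
  define A where "A = eval_mat M z"
  have A: "A \<in> carrier_mat n n"
    using M by (simp add: A_def eval_mat_def)
  have S: "S \<subseteq> {..<n}" and T: "T \<subseteq> {..<n}"
    using ST by auto
  \<comment> \<open>The reduction is defined with the complement of \<open>S\<close> in place of \<open>T\<close>.\<close>
  have T_eq: "{..<dim_row M} - S = T"
    using M ST by auto
  note val = mat_has_value_submatrix[OF M _ _ pf, folded A_def]
  note cM = submatrix_carrier[OF M] and cA = submatrix_carrier[OF A]
  let ?N = "submatrix M T T - ratfun_var \<cdot>\<^sub>m 1\<^sub>m (card T)"
  let ?B = "submatrix A T T - z \<cdot>\<^sub>m 1\<^sub>m (card T)"
  have N: "?N \<in> carrier_mat (card T) (card T)"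
    using cM[OF T T] by (intro minus_carrier_mat) auto
  have NB: "mat_has_value ?N z ?B"
    by (rule mat_has_value_minus[OF cM[OF T T] cA[OF T T] val[OF T T]
          _ _ mat_has_value_smult[OF one_carrier_mat one_carrier_mat mat_has_value_one has_value_ratfun_var]])
       auto
  have "eval_mat (submatrix M T T) z = submatrix A T T"
    using val[OF T T] by (simp add: mat_has_value_def)
  then have "invertible_mat ?B"
    using assms(6) by simp
  then obtain D where D: "D \<in> carrier_mat (card T) (card T)"
    "the (mat_inverse ?N) \<in> carrier_mat (card T) (card T)"
    "mat_has_value (the (mat_inverse ?N)) z D" "?B * D = 1\<^sub>m (card T)" "D * ?B = 1\<^sub>m (card T)"
    using mat_has_value_mat_inverse[OF N NB] by metis
  let ?R = "submatrix A S S - submatrix A S T * D * submatrix A T S"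
  have R: "mat_has_value (isospectral_reduction M S) z ?R"
    unfolding isospectral_reduction_def Let_def T_eq
    by (rule mat_has_value_minus[of _ "card S" "card S"] mat_has_value_mult[of _ "card S" "card T" _ _ _ "card S"]
          mat_has_value_mult[of _ "card S" "card T" _ _ _ "card T"] val S T mult_carrier_mat cM cA D(1-3))+
  have eigM: "ratfun_eigenvector M u z \<longleftrightarrow> eigenvector A u z" for u
    using pf by (simp add: ratfun_eigenvector_def A_def)
  have eigR: "ratfun_eigenvector (isospectral_reduction M S) v z \<longleftrightarrow> eigenvector ?R v z" for v
    using R by (simp add: ratfun_eigenvector_def mat_has_value_def)
  have bij: "bij_betw (\<lambda>u. vec_restrict u S) {u. ratfun_eigenvector M u z}
      {v. ratfun_eigenvector (isospectral_reduction M S) v z}"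
    using bij_betw_eigenvectors_schur_complement[OF A ST D(1,4,5)] unfolding eigM eigR .
  moreover have "\<exists>u. ratfun_eigenvector M u z \<and> v = vec_restrict u S"
    if "ratfun_eigenvector (isospectral_reduction M S) v z" for v
    using bij that unfolding bij_betw_def by blast
  moreover have "pole_free_mat (isospectral_reduction M S) z"
    using R by (simp add: mat_has_value_def)
  ultimately show ?thesis
    by blast
qed

end
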